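(* Let $(X,\mu,\mathcal{E},\mathcal{F})$ be a Dirichlet space whose heat kernel satisfies $p_t(x,y)\le C_ht^{-\beta}$ for $\mu\times\mu$-a.e. $(x,y)\in X\times X$ and every $t>0$, for some constants $C_h>0$ and $\beta>0$. Let $p>1$ and assume that condition $(\mathrm{PPI}_p)$ is satisfied and that $p\alpha_p=\beta$. Then there exist constants $c,C>0$ such that $$\int_X\Big(e^{c|f|^{\frac{p}{p-1}}}-1\Big)\,d\mu\le C\,\|f\|_{L^1(X,\mu)}$$ holds for every $f\in W^{1,p}(\mathcal{E})$ with $\mathbf{Var}_{p,\mathcal{E}}(f)=1$.
   Context: $X$ is a good measurable space (like a Polish or Radon space) with a $\sigma$-finite measure $\mu$ supported on $X$, and $(\mathcal{E},\mathcal{F})$, $\mathcal{F}=\mathrm{dom}\,\mathcal{E}$, is a Dirichlet form on $L^2(X,\mu)$. Its heat semigroup $\{P_t\}_{t\ge0}$, extended to all $L^p(X,\mu)$, $1\le p\le\infty$, is assumed conservative ($P_t1=1$), and it admits a measurable heat kernel $p_t(x,y)$. For $p\ge1$, $\alpha\ge0$ (with $P_t(|f-f(y)|^p)(y)$ meaning $P_t$ applied to $x\mapsto|f(x)-f(y)|^p$, evaluated at $y$), $$\mathbf{B}^{p,\alpha}(X)=\Big\{f\in L^p(X,\mu):\limsup_{t\to0^+}t^{-\alpha}\Big(\int_XP_t(|f-f(y)|^p)(y)\,d\mu(y)\Big)^{1/p}<\infty\Big\}.$$ Set $\alpha_p=\sup\{\alpha>0:\mathbf{B}^{p,\alpha}(X)\text{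 contains non a.e. constant functions}\}$, $W^{1,p}(\mathcal{E})=\mathbf{B}^{p,\alpha_p}(X)$ for $p>1$, and for $f\in W^{1,p}(\mathcal{E})$ $$\mathbf{Var}_{p,\mathcal{E}}(f)=\liminf_{t\to0^+}t^{-\alpha_p}\Big(\int_XP_t(|f-f(y)|^p)(y)\,d\mu(y)\Big)^{1/p}.$$ Condition $(\mathrm{PPI}_p)$: there is a constant $C_p>0$ such that $\|P_tf-f\|_{L^p(X,\mu)}\le C_p\,t^{\alpha_p}\,\mathbf{Var}_{p,\mathcal{E}}(f)$ for every $t\ge0$ and $f\in W^{1,p}(\mathcal{E})$. *)

theory Defs
  imports "HOL-Analysis.Analysis"
begin

section \<open>Lebesgue spaces\<close>

text \<open>
  Elements of \<open>L\<^sup>p\<close> are represented by measurable functions; equality in \<open>L\<^sup>p\<close> is equality almost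
  everywhere. Norms take values in \<open>[0, \<infinity>]\<close>.
\<close>

definition epowr :: "ennreal \<Rightarrow> real \<Rightarrow> ennreal" where
  "epowr a r = (if a = \<infinity> then \<infinity> else ennreal (enn2real a powr r))" \<comment> \<open>used for \<open>r > 0\<close> only\<close>

definition Lp_norm :: "'a measure \<Rightarrow> real \<Rightarrow> ('a \<Rightarrow> real) \<Rightarrow> ennreal" where
  "Lp_norm M p f = epowr (\<integral>\<^sup>+x. ennreal (\<bar>f x\<bar> powr p) \<partial>M) (1 / p)"

definition Lp :: "'a measure \<Rightarrow> real \<Rightarrow> ('a \<Rightarrow> real) set" where
  "Lp M p = {f \<in> borel_measurable M. Lp_norm M p f < \<infinity>}"

definition Linf :: "'a measure \<Rightarrow> ('a \<Rightarrow> real) set" where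
  "Linf M = {f \<in> borel_measurable M. \<exists>C. AE x in M. \<bar>f x\<bar> \<le> C}"

section \<open>Dirichlet spaces\<close>

text \<open>
  Radon spaces in the sense of Schwartz; they include all Polish spaces.
\<close>

definition radon_space :: "'a::t2_space itself \<Rightarrow> bool" where
  "radon_space _ \<longleftrightarrow>
    (\<forall>N :: 'a measure. sets N = sets borel \<longrightarrow> finite_measure N \<longrightarrow>
      (\<forall>B \<in> sets borel. emeasure N B = (SUP K \<in> {K. K \<subseteq> B \<and> compact K}. emeasure N K)))"

lemma radon_space_polish: "radon_space TYPE('a::polish_space)"
  unfolding radon_space_def
  by (auto intro!: inner_regular simp: finite_measure.emeasure_finite)

locale dirichlet_space = sigma_finite_measure M for M :: "'a::t2_space measure" +
  fixes \<E> :: "('a \<Rightarrow> real) \<Rightarrow> ('a \<Rightarrow> real) \<Rightarrow> real"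
    and \<F> :: "('a \<Rightarrow> real) set"
  assumes good_space: "radon_space TYPE('a)"
    and sets_borel: "sets M = sets borel"
    and full_support: "\<And>U. open U \<Longrightarrow> U \<noteq> {} \<Longrightarrow> emeasure M U > 0"
    and dom_L2: "\<F> \<subseteq> Lp M 2"
    and dom_AE: "\<And>f g. f \<in> \<F> \<Longrightarrow> g \<in> borel_measurable M \<Longrightarrow> AE x in M. f x = g x \<Longrightarrow> g \<in> \<F>"
    and dom_zero: "(\<lambda>_. 0) \<in> \<F>"
    and dom_add: "\<And>f g. f \<in> \<F> \<Longrightarrow> g \<in> \<F> \<Longrightarrow> (\<lambda>x. f x + g x) \<in> \<F>"
    and dom_scale: "\<And>f a. f \<in> \<F> \<Longrightarrow> (\<lambda>x. a * f x) \<in> \<F>"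
    and dom_dense: "\<And>f e. f \<in> Lp M 2 \<Longrightarrow> e > 0 \<Longrightarrow>
      \<exists>g \<in> \<F>. Lp_norm M 2 (\<lambda>x. f x - g x) < ennreal e"
    and form_AE: "\<And>f f' g. f \<in> \<F> \<Longrightarrow> f' \<in> \<F> \<Longrightarrow> g \<in> \<F> \<Longrightarrow>
      AE x in M. f x = f' x \<Longrightarrow> \<E> f g = \<E> f' g"
    and form_add: "\<And>f f' g. f \<in> \<F> \<Longrightarrow> f' \<in> \<F> \<Longrightarrow> g \<in> \<F> \<Longrightarrow>
      \<E> (\<lambda>x. f x + f' x) g = \<E> f g + \<E> f' g"
    and form_scale: "\<And>f g a. f \<in> \<F> \<Longrightarrow> g \<in> \<F> \<Longrightarrow> \<E> (\<lambda>x. a * f x) g = a * \<E> f g"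
    and form_sym: "\<And>f g. f \<in> \<F> \<Longrightarrow> g \<in> \<F> \<Longrightarrow> \<E> f g = \<E> g f"
    and form_nonneg: "\<And>f. f \<in> \<F> \<Longrightarrow> \<E> f f \<ge> 0"
    \<comment> \<open>\<open>\<F>\<close> is complete for the norm \<open>(\<E>(f, f) + \<parallel>f\<parallel>\<^sub>2\<^sup>2)\<^sup>1\<^sup>/\<^sup>2\<close>\<close>
    and form_closed: "\<And>u :: nat \<Rightarrow> 'a \<Rightarrow> real. (\<And>n. u n \<in> \<F>) \<Longrightarrow>
      (\<And>e. e > 0 \<Longrightarrow> \<exists>N. \<forall>m\<ge>N. \<forall>n\<ge>N.
        \<E> (\<lambda>x. u m x - u n x) (\<lambda>x. u m x - u n x) + (\<integral>x. (u m x - u n x)\<^sup>2 \<partial>M) < e) \<Longrightarrow>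
      \<exists>v \<in> \<F>. (\<lambda>n. \<E> (\<lambda>x. u n x - v x) (\<lambda>x. u n x - v x)
                    + (\<integral>x. (u n x - v x)\<^sup>2 \<partial>M)) \<longlonglongrightarrow> 0"
    and form_markov: "\<And>f. f \<in> \<F> \<Longrightarrow>
      (\<lambda>x. min 1 (max 0 (f x))) \<in> \<F> \<and>
      \<E> (\<lambda>x. min 1 (max 0 (f x))) (\<lambda>x. min 1 (max 0 (f x))) \<le> \<E> f f"

section \<open>The heat semigroup and its kernel\<close>

text \<open>
  A single family \<open>P t\<close> acts on all the \<open>L\<^sup>q\<close>, \<open>1 \<le> q \<le> \<infinity>\<close>. On \<open>L\<^sup>2\<close> it is the strongly continuous
  self-adjoint contraction semigroup whose generator is the operator \<open>L\<close> of the form, that is,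
  \<open>f \<in> dom L\<close> with \<open>L f = h\<close> iff \<open>f \<in> \<F>\<close> and \<open>\<E>(f, g) = - \<langle>h, g\<rangle>\<close> for every \<open>g \<in> \<F>\<close>. For
  \<open>q < \<infinity>\<close> the contraction property determines the extension from \<open>L\<^sup>2 \<inter> L\<^sup>q\<close> to \<open>L\<^sup>q\<close>, and on
  \<open>L\<^sup>\<infinity>\<close> the operator \<open>P t\<close> is the adjoint of \<open>P t\<close> on \<open>L\<^sup>1\<close>.
\<close>

locale heat_semigroup = dirichlet_space M \<E> \<F>
  for M :: "'a::t2_space measure" and \<E> \<F> +
  fixes P :: "real \<Rightarrow> ('a \<Rightarrow> real) \<Rightarrow> 'a \<Rightarrow> real"
  assumes Lp_closed: "\<And>t q f. t \<ge> 0 \<Longrightarrow> q \<ge> 1 \<Longrightarrow> f \<in> Lp M q \<Longrightarrow> P t f \<in> Lp M q"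
    and Lp_contraction: "\<And>t q f. t \<ge> 0 \<Longrightarrow> q \<ge> 1 \<Longrightarrow> f \<in> Lp M q \<Longrightarrow>
      Lp_norm M q (P t f) \<le> Lp_norm M q f"
    and Lp_add: "\<And>t q f g. t \<ge> 0 \<Longrightarrow> q \<ge> 1 \<Longrightarrow> f \<in> Lp M q \<Longrightarrow> g \<in> Lp M q \<Longrightarrow>
      AE x in M. P t (\<lambda>y. f y + g y) x = P t f x + P t g x"
    and Lp_scale: "\<And>t q f a. t \<ge> 0 \<Longrightarrow> q \<ge> 1 \<Longrightarrow> f \<in> Lp M q \<Longrightarrow>
      AE x in M. P t (\<lambda>y. a * f y) x = a * P t f x"
    and Linf_closed: "\<And>t f. t \<ge> 0 \<Longrightarrow> f \<in> Linf M \<Longrightarrow> P t f \<in> Linf M"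
    and Linf_adjoint: "\<And>t f g. t \<ge> 0 \<Longrightarrow> f \<in> Linf M \<Longrightarrow> g \<in> Lp M 1 \<Longrightarrow>
      (\<integral>x. P t f x * g x \<partial>M) = (\<integral>x. f x * P t g x \<partial>M)"
    and L2_zero: "\<And>f. f \<in> Lp M 2 \<Longrightarrow> AE x in M. P 0 f x = f x"
    and L2_semigroup: "\<And>s t f. s \<ge> 0 \<Longrightarrow> t \<ge> 0 \<Longrightarrow> f \<in> Lp M 2 \<Longrightarrow>
      AE x in M. P (s + t) f x = P s (P t f) x"
    and L2_symmetric: "\<And>t f g. t \<ge> 0 \<Longrightarrow> f \<in> Lp M 2 \<Longrightarrow> g \<in> Lp M 2 \<Longrightarrow>
      (\<integral>x. P t f x * g x \<partial>M) = (\<integral>x. f x * P t g x \<partial>M)"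
    and L2_continuous: "\<And>f. f \<in> Lp M 2 \<Longrightarrow>
      ((\<lambda>t. Lp_norm M 2 (\<lambda>x. P t f x - f x)) \<longlongrightarrow> 0) (at_right 0)"
    and generator: "\<And>f h. f \<in> Lp M 2 \<Longrightarrow> h \<in> Lp M 2 \<Longrightarrow>
      ((\<lambda>t. Lp_norm M 2 (\<lambda>x. (P t f x - f x) / t - h x)) \<longlongrightarrow> 0) (at_right 0) \<longleftrightarrow>
      f \<in> \<F> \<and> (\<forall>g \<in> \<F>. \<E> f g = - (\<integral>x. h x * g x \<partial>M))"

definition conservative :: "'a measure \<Rightarrow> (real \<Rightarrow> ('a \<Rightarrow> real) \<Rightarrow> 'a \<Rightarrow> real) \<Rightarrow> bool" where
  "conservative M P \<longleftrightarrow> (\<forall>t\<ge>0. AE x in M. P t (\<lambda>_. 1) x = 1)"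

definition heat_kernel ::
    "'a measure \<Rightarrow> (real \<Rightarrow> ('a \<Rightarrow> real) \<Rightarrow> 'a \<Rightarrow> real) \<Rightarrow> (real \<Rightarrow> 'a \<Rightarrow> 'a \<Rightarrow> real) \<Rightarrow> bool" where
  "heat_kernel M P k \<longleftrightarrow>
    (\<forall>t>0. (\<lambda>(x, y). k t x y) \<in> borel_measurable (M \<Otimes>\<^sub>M M) \<and>
      (\<forall>x y. k t x y \<ge> 0) \<and>
      (\<forall>f \<in> Linf M \<union> (\<Union>q \<in> {1..}. Lp M q).
        AE x in M. integrable M (\<lambda>y. k t x y * f y) \<and> P t f x = (\<integral>y. k t x y * f y \<partial>M)))"

text \<open>
  \<open>P\<^sub>t g\<close> for nonnegative measurable \<open>g\<close>, evaluated pointwise by means of the kernel. This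
  gives a meaning to \<open>P\<^sub>t (\<bar>f - f(y)\<bar>\<^sup>p)(y)\<close>, where the function depends on the evaluation point
  and need not lie in any \<open>L\<^sup>q\<close>.
\<close>

definition heat_op :: "'a measure \<Rightarrow> (real \<Rightarrow> 'a \<Rightarrow> 'a \<Rightarrow> real) \<Rightarrow> real \<Rightarrow> ('a \<Rightarrow> real) \<Rightarrow> 'a \<Rightarrow> ennreal" where
  "heat_op M k t g y = (\<integral>\<^sup>+x. ennreal (k t y x) * ennreal (g x) \<partial>M)"

section \<open>Besov spaces, critical exponents, variation\<close>

definition besov_quotient ::
    "'a measure \<Rightarrow> (real \<Rightarrow> 'a \<Rightarrow> 'a \<Rightarrow> real) \<Rightarrow> real \<Rightarrow> real \<Rightarrow> ('a \<Rightarrow> real) \<Rightarrow> real \<Rightarrow> ennreal" where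
  "besov_quotient M k p \<alpha> f t =
    ennreal (t powr - \<alpha>) * epowr (\<integral>\<^sup>+y. heat_op M k t (\<lambda>x. \<bar>f x - f y\<bar> powr p) y \<partial>M) (1 / p)"

definition besov :: "'a measure \<Rightarrow> (real \<Rightarrow> 'a \<Rightarrow> 'a \<Rightarrow> real) \<Rightarrow> real \<Rightarrow> real \<Rightarrow> ('a \<Rightarrow> real) set" where
  "besov M k p \<alpha> = {f \<in> Lp M p. Limsup (at_right 0) (besov_quotient M k p \<alpha> f) < \<infinity>}"

definition critical_exponent :: "'a measure \<Rightarrow> (real \<Rightarrow> 'a \<Rightarrow> 'a \<Rightarrow> real) \<Rightarrow> real \<Rightarrow> ereal" where
  "critical_exponent M k p =
    Sup {ereal \<alpha> | \<alpha>. \<alpha> > 0 \<and> (\<exists>f \<in> besov M k p \<alpha>. \<not> (\<exists>c. AE x in M. f x = c))}"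

text \<open>
  The notions below use the critical exponent as a real number and are meaningful when it is finite.
\<close>

definition W1 :: "'a measure \<Rightarrow> (real \<Rightarrow> 'a \<Rightarrow> 'a \<Rightarrow> real) \<Rightarrow> real \<Rightarrow> ('a \<Rightarrow> real) set" where
  "W1 M k p = besov M k p (real_of_ereal (critical_exponent M k p))"

definition Var :: "'a measure \<Rightarrow> (real \<Rightarrow> 'a \<Rightarrow> 'a \<Rightarrow> real) \<Rightarrow> real \<Rightarrow> ('a \<Rightarrow> real) \<Rightarrow> ennreal" where
  "Var M k p f =
    Liminf (at_right 0) (besov_quotient M k p (real_of_ereal (critical_exponent M k p)) f)"

definition PPI ::
    "'a measure \<Rightarrow> (real \<Rightarrow> ('a \<Rightarrow> real) \<Rightarrow> 'a \<Rightarrow> real) \<Rightarrow> (real \<Rightarrow> 'a \<Rightarrow> 'a \<Rightarrow> real) \<Rightarrow> real \<Rightarrow> bool" where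
  "PPI M P k p \<longleftrightarrow> (\<exists>C>0. \<forall>t\<ge>0. \<forall>f \<in> W1 M k p.
    Lp_norm M p (\<lambda>x. P t f x - f x)
      \<le> ennreal (C * t powr real_of_ereal (critical_exponent M k p)) * Var M k p f)"

end

theory Submission
  imports Defs
begin

text \<open>
  Truncation turns the pseudo-Poincare inequality into exponential decay of the distribution
  function \<open>\<nu>(s) = \<mu>(\<bar>f\<bar> \<ge> s)\<close>. For the layer \<open>g = max 0 (min (\<bar>f\<bar> - a) h)\<close> the heat kernel bound
  gives \<open>\<parallel>P\<^sub>t g\<parallel>\<^sub>\<infinity> \<le> C\<^sub>h t\<^sup>-\<^sup>\<beta> h \<nu>(a)\<close>. At the time with \<open>t\<^sup>\<beta> = 2 C\<^sub>h \<nu>(a)\<close> this is \<open>h/2\<close>, so that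
  \<open>\<bar>P\<^sub>t g - g\<bar> \<ge> h/2\<close> wherever \<open>\<bar>f\<bar> \<ge> a + h\<close>. Since \<open>p \<alpha>\<^sub>p = \<beta>\<close>, the right-hand side of
  \<open>(PPI\<^sub>p)\<close> raised to the power \<open>p\<close> is proportional to \<open>t\<^sup>\<beta>\<close>, hence to \<open>\<nu>(a)\<close>, and Markov's
  inequality yields (\<open>superlevel_decay_by_layer\<close>)
  \<open>\<nu>(a + h) \<le> D h\<^sup>-\<^sup>p Var(g)\<^sup>p \<nu>(a)\<close>: this linear dependence on \<open>\<nu>(a)\<close> is where the critical
  relation \<open>p \<alpha>\<^sub>p = \<beta>\<close> is used.

  The variations of disjoint layers are \<open>\<ell>\<^sup>p\<close>-summable, \<open>\<Sum> Var(g\<^sub>i)\<^sup>p \<le> Var(f)\<^sup>p\<close>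
  (\<open>sum_Var_layers_le\<close>), because increments of the layers add up to at most the increment of \<open>f\<close>
  and a lower limit is superadditive. If \<open>Var(f) = 1\<close>, then iterating the decay over \<open>N\<close> layers of
  equal height \<open>h\<close> and applying the inequality of arithmetic and geometric means costs a factor
  \<open>(D h\<^sup>-\<^sup>p / N)\<^sup>N\<close>. It equals \<open>e\<^sup>-\<^sup>N\<close> for \<open>h = K N\<^sup>-\<^sup>1\<^sup>/\<^sup>p\<close> with \<open>K\<^sup>p = e D\<close>,
  and the \<open>N\<close> layers then reach the height \<open>K N\<^sup>1\<^sup>/\<^sup>q\<close>, where \<open>q = p / (p - 1)\<close>
  (\<open>exponential_decay_of_tail\<close>). A tail of size \<open>e\<^sup>-\<^sup>N\<close> at this height means that
  \<open>exp (c \<bar>f\<bar>\<^sup>q)\<close> is integrable over \<open>\<bar>f\<bar> \<ge> K\<close> for small \<open>c\<close>, and on \<open>\<bar>f\<bar> \<le> K\<close> the integrand is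
  dominated by a multiple of \<open>\<bar>f\<bar>\<close> (\<open>exp_integral_le_of_exponential_tail\<close>).
\<close>

section \<open>Layers of a real function\<close>

lemma sum_powr_le_powr_sum:
  fixes d :: "'i \<Rightarrow> real"
  assumes "finite I" and d: "\<And>i. i \<in> I \<Longrightarrow> 0 \<le> d i" and p: "1 \<le> p"
  shows "(\<Sum>i\<in>I. d i powr p) \<le> (\<Sum>i\<in>I. d i) powr p"
proof -
  define S where "S = (\<Sum>i\<in>I. d i)"
  have *: "x powr p = x * x powr (p - 1)" if "0 \<le> x" for x :: real
    using that by (cases "x = 0") (auto simp: powr_diff)
  have "(\<Sum>i\<in>I. d i powr p) \<le> (\<Sum>i\<in>I. d i * S powr (p - 1))"
  proof (rule sum_mono)
    fix i assume i: "i \<in> I"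
    have "d i \<le> S"
      unfolding S_def using assms i by (intro member_le_sum) auto
    then show "d i powr p \<le> d i * S powr (p - 1)"
      using d[OF i] p by (subst *) (auto intro!: mult_left_mono powr_mono2)
  qed
  also have "\<dots> = S * S powr (p - 1)"
    by (simp add: S_def sum_distrib_right)
  also have "\<dots> = S powr p"
    using * sum_nonneg[of I d] d by (simp add: S_def)
  finally show ?thesis unfolding S_def .
qed

definition layer :: "real \<Rightarrow> real \<Rightarrow> real \<Rightarrow> real" where
  "layer a h s = max 0 (min (s - a) h)"

lemma layer_mono: "s \<le> s' \<Longrightarrow> layer a h s \<le> layer a h s'"
  by (auto simp: layer_def)

lemma layer_lipschitz: "\<bar>layer a h s - layer a h s'\<bar> \<le> \<bar>s - s'\<bar>"
  unfolding layer_def by linarith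

lemma sum_layers:
  assumes "0 \<le> h"
  shows "(\<Sum>i<N. layer (a + real i * h) h s) = layer a (real N * h) s"
proof (induction N)
  case (Suc N)
  have "layer a r s + layer (a + r) h s = layer a (r + h) s" if "0 \<le> r" for r
    using assms that unfolding layer_def by (simp add: max_def min_def)
  from this[of "real N * h"]
  have "layer a (real N * h) s + layer (a + real N * h) h s = layer a (real N * h + h) s"
    using assms by simp
  then show ?case using Suc by (simp add: algebra_simps)
qed (simp add: layer_def)

text \<open>
  All layers are nondecreasing in \<open>\<bar>s\<bar>\<close>, so the absolute increments telescope to the increment of
  one tall layer, which is a contraction of \<open>s\<close>; the power is then handled by the embedding of
  \<open>\<ell>\<^sup>1\<close> into \<open>\<ell>\<^sup>p\<close>.
\<close>

lemma sum_layer_differences_le: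
  assumes "0 \<le> h" "1 \<le> p"
  shows "(\<Sum>i<N. \<bar>layer (a + real i * h) h \<bar>s\<bar> - layer (a + real i * h) h \<bar>s'\<bar>\<bar> powr p)
    \<le> \<bar>s - s'\<bar> powr p"
proof -
  let ?d = "\<lambda>i u v. layer (a + real i * h) h u - layer (a + real i * h) h v"
  have le: "(\<Sum>i<N. \<bar>?d i u v\<bar>) \<le> \<bar>u - v\<bar>" if "v \<le> u" for u v
  proof -
    have "(\<Sum>i<N. \<bar>?d i u v\<bar>) = (\<Sum>i<N. ?d i u v)"
      using layer_mono[OF that] by (intro sum.cong) auto
    also have "\<dots> = layer a (real N * h) u - layer a (real N * h) v"
      using assms by (simp add: sum_subtractf sum_layers)
    also have "\<dots> \<le> \<bar>u - v\<bar>"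
      using layer_lipschitz[of a "real N * h" u v] by linarith
    finally show ?thesis .
  qed
  have "(\<Sum>i<N. \<bar>?d i \<bar>s\<bar> \<bar>s'\<bar>\<bar>) \<le> \<bar>\<bar>s\<bar> - \<bar>s'\<bar>\<bar>"
    using le[of "\<bar>s'\<bar>" "\<bar>s\<bar>"] le[of "\<bar>s\<bar>" "\<bar>s'\<bar>"] by (cases "\<bar>s'\<bar> \<le> \<bar>s\<bar>") (auto simp: abs_minus_commute)
  also have "\<dots> \<le> \<bar>s - s'\<bar>" by (rule abs_triangle_ineq3)
  finally have *: "(\<Sum>i<N. \<bar>?d i \<bar>s\<bar> \<bar>s'\<bar>\<bar>) \<le> \<bar>s - s'\<bar>" .
  have "(\<Sum>i<N. \<bar>?d i \<bar>s\<bar> \<bar>s'\<bar>\<bar> powr p) \<le> (\<Sum>i<N. \<bar>?d i \<bar>s\<bar> \<bar>s'\<bar>\<bar>) powr p"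
    using assms by (intro sum_powr_le_powr_sum) auto
  also have "\<dots> \<le> \<bar>s - s'\<bar> powr p"
    using * assms by (intro powr_mono2) (auto intro: sum_nonneg)
  finally show ?thesis .
qed

section \<open>Inequality of means, and lower limits in the extended half-line\<close>

lemma prod_le_power_mean:
  fixes w :: "nat \<Rightarrow> real"
  assumes w: "\<And>i. i < N \<Longrightarrow> 0 \<le> w i" and "N > 0"
  shows "(\<Prod>i<N. w i) \<le> ((\<Sum>i<N. w i) / real N) ^ N"
proof -
  have "(\<Prod>i<N. w i) powr (1 / real N) \<le> (\<Sum>i<N. w i) / real N"
    using arith_geom_mean[of "{..<N}" w] assms by (auto simp: sum_divide_distrib)
  then have "((\<Prod>i<N. w i) powr (1 / real N)) ^ N \<le> ((\<Sum>i<N. w i) / real N) ^ N"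
    by (intro power_mono) auto
  moreover have "((\<Prod>i<N. w i) powr (1 / real N)) ^ N = (\<Prod>i<N. w i)"
    using assms prod_nonneg[of "{..<N}" w] by (subst powr_realpow'[symmetric]) (auto simp: powr_powr)
  ultimately show ?thesis by simp
qed

lemma epowr_mono: "a \<le> b \<Longrightarrow> 0 \<le> r \<Longrightarrow> epowr a r \<le> epowr b r"
  unfolding epowr_def
  by (auto simp: top_unique infinity_ennreal_def less_top intro!: ennreal_leI powr_mono2 enn2real_mono)

lemma epowr_epowr: "epowr (epowr a r) s = epowr a (r * s)"
  by (auto simp: epowr_def powr_powr)

lemma epowr_one [simp]: "epowr a 1 = a"
  by (cases a) (auto simp: epowr_def)

lemma epowr_mult:
  assumes "0 < r" "0 \<le> c"
  shows "epowr (ennreal c * a) r = ennreal (c powr r) * epowr a r"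
proof (cases a)
  case (real b)
  then show ?thesis
    using assms by (simp add: epowr_def ennreal_mult'[symmetric] powr_mult)
next
  case top
  then show ?thesis
    using assms by (cases "c = 0") (auto simp: epowr_def ennreal_mult_top)
qed

lemma epowr_strict_mono: "0 < r \<Longrightarrow> epowr a r < epowr b r \<longleftrightarrow> a < b"
  using epowr_mono[of b a r] epowr_mono[of "epowr b r" "epowr a r" "1 / r"] 
  by (auto simp: epowr_epowr not_le[symmetric])

text \<open>
  Raising to a positive power is an increasing bijection of \<open>[0, \<infinity>]\<close>, so it commutes with lower
  limits. The inequality below, applied to the exponent and to its inverse, gives both directions.
\<close>

lemma Liminf_epowr:
  assumes r: "0 < r"
  shows "Liminf F (\<lambda>t. epowr (\<phi> t) r) = epowr (Liminf F \<phi>) r"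
proof -
  have le: "epowr (Liminf F \<psi>) r \<le> Liminf F (\<lambda>t. epowr (\<psi> t) r)" if "0 < r"
    for r and \<psi> :: "'a \<Rightarrow> ennreal"
    unfolding le_Liminf_iff
  proof (intro allI impI)
    fix y assume "y < epowr (Liminf F \<psi>) r"
    then have "epowr y (1 / r) < Liminf F \<psi>"
      using that epowr_strict_mono[of r "epowr y (1 / r)" "Liminf F \<psi>"] by (simp add: epowr_epowr)
    then have "eventually (\<lambda>t. epowr y (1 / r) < \<psi> t) F"
      using le_Liminf_iff[of "Liminf F \<psi>" F \<psi>] by simp
    then show "eventually (\<lambda>t. y < epowr (\<psi> t) r) F"
    proof eventually_elim
      case (elim t)
      then show ?case
        using that epowr_strict_mono[of r "epowr y (1 / r)" "\<psi> t"] by (simp add: epowr_epowr)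
    qed
  qed
  have "epowr (Liminf F (\<lambda>t. epowr (\<phi> t) r)) (1 / r) \<le> Liminf F \<phi>"
    using le[of "1 / r" "\<lambda>t. epowr (\<phi> t) r"] r by (simp add: epowr_epowr)
  then have "Liminf F (\<lambda>t. epowr (\<phi> t) r) \<le> epowr (Liminf F \<phi>) r"
    using r epowr_mono[of "epowr (Liminf F (\<lambda>t. epowr (\<phi> t) r)) (1 / r)" "Liminf F \<phi>" r]
    by (simp add: epowr_epowr)
  with le[OF r] show ?thesis by (rule antisym[rotated])
qed

lemma Liminf_add_le_ennreal:
  fixes f g :: "'a \<Rightarrow> ennreal"
  shows "Liminf F f + Liminf F g \<le> Liminf F (\<lambda>x. f x + g x)"
proof -
  let ?I = "{P. eventually P F}"
  have "Liminf F f + Liminf F g = (SUP P\<in>?I. Inf (f ` Collect P) + Inf (g ` Collect P))"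
    unfolding Liminf_def
  proof (rule SUP_add_directed_ennreal[symmetric])
    fix P Q assume "P \<in> ?I" "Q \<in> ?I"
    then show "\<exists>R\<in>?I. Inf (f ` Collect P) + Inf (g ` Collect Q) \<le> Inf (f ` Collect R) + Inf (g ` Collect R)"
      by (intro bexI[of _ "\<lambda>x. P x \<and> Q x"] add_mono INF_superset_mono) (auto intro: eventually_conj)
  qed
  also have "\<dots> \<le> Liminf F (\<lambda>x. f x + g x)"
    unfolding Liminf_def by (intro SUP_mono') (auto intro!: INF_greatest add_mono INF_lower)
  finally show ?thesis .
qed

lemma sum_Liminf_le_Liminf_sum:
  fixes f :: "'i \<Rightarrow> 'a \<Rightarrow> ennreal"
  assumes "finite I"
  shows "(\<Sum>i\<in>I. Liminf F (f i)) \<le> Liminf F (\<lambda>x. \<Sum>i\<in>I. f i x)"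
  using assms
proof induction
  case (insert i I)
  then show ?case
    using order_trans[OF add_left_mono[OF insert.IH] Liminf_add_le_ennreal] by simp
qed simp

section \<open>Summability of the variations of layers\<close>

definition heat_energy ::
    "'a measure \<Rightarrow> (real \<Rightarrow> 'a \<Rightarrow> 'a \<Rightarrow> real) \<Rightarrow> real \<Rightarrow> ('a \<Rightarrow> real) \<Rightarrow> real \<Rightarrow> ennreal" where
  "heat_energy M k p f t = (\<integral>\<^sup>+y. heat_op M k t (\<lambda>x. \<bar>f x - f y\<bar> powr p) y \<partial>M)"

lemma besov_quotient_energy: "besov_quotient M k p \<alpha> f t =
    ennreal (t powr - \<alpha>) * epowr (heat_energy M k p f t) (1 / p)"
  by (simp add: besov_quotient_def heat_energy_def)

lemma heat_energy_mono:
  assumes "\<And>x y. \<bar>g x - g y\<bar> \<le> \<bar>f x - f y\<bar>" "0 \<le> p"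
  shows "heat_energy M k p g t \<le> heat_energy M k p f t"
  unfolding heat_energy_def heat_op_def
  using assms by (intro nn_integral_mono mult_left_mono ennreal_leI powr_mono2) auto

lemma sum_heat_energy_layers_le:
  assumes sf: "sigma_finite_measure M"
    and k: "(\<lambda>(x, y). k t x y) \<in> borel_measurable (M \<Otimes>\<^sub>M M)"
    and f: "f \<in> borel_measurable M" and h: "0 \<le> h" and p: "1 \<le> p"
  shows "(\<Sum>i<N. heat_energy M k p (\<lambda>x. layer (a + real i * h) h \<bar>f x\<bar>) t) \<le> heat_energy M k p f t"
proof -
  interpret sigma_finite_measure M by fact
  let ?g = "\<lambda>i x. layer (a + real i * h) h \<bar>f x\<bar>"
  let ?e = "\<lambda>i y x. ennreal (k t y x) * ennreal (\<bar>?g i x - ?g i y\<bar> powr p)"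
  have g: "?g i \<in> borel_measurable M" for i
    using f unfolding layer_def by measurable
  note [measurable] = g k
  have pair: "(\<lambda>(y, x). ?e i y x) \<in> borel_measurable (M \<Otimes>\<^sub>M M)" for i
  proof -
    have "(\<lambda>z. ennreal (case z of (y, x) \<Rightarrow> k t y x) *
        ennreal (\<bar>?g i (snd z) - ?g i (fst z)\<bar> powr p)) \<in> borel_measurable (M \<Otimes>\<^sub>M M)"
      by measurable
    then show ?thesis by (simp add: case_prod_beta)
  qed
  have "(\<Sum>i<N. heat_energy M k p (?g i) t) = (\<Sum>i<N. \<integral>\<^sup>+y. \<integral>\<^sup>+x. ?e i y x \<partial>M \<partial>M)"
    by (simp add: heat_energy_def heat_op_def)
  also have "\<dots> = (\<integral>\<^sup>+y. (\<Sum>i<N. \<integral>\<^sup>+x. ?e i y x \<partial>M) \<partial>M)"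
    by (rule nn_integral_sum[symmetric]) (rule borel_measurable_nn_integral[OF pair])
  also have "\<dots> = (\<integral>\<^sup>+y. \<integral>\<^sup>+x. (\<Sum>i<N. ?e i y x) \<partial>M \<partial>M)"
    using pair by (intro nn_integral_cong nn_integral_sum[symmetric]) (auto dest: measurable_Pair2)
  also have "\<dots> \<le> heat_energy M k p f t"
    unfolding heat_energy_def heat_op_def sum_distrib_left[symmetric]
    using h p by (intro nn_integral_mono mult_left_mono)
      (auto intro!: ennreal_leI sum_layer_differences_le)
  finally show ?thesis .
qed

lemma epowr_Var:
  assumes p: "1 \<le> p"
  shows "epowr (Var M k p f) p = Liminf (at_right 0)
    (\<lambda>t. ennreal (t powr - (real_of_ereal (critical_exponent M k p) * p)) * heat_energy M k p f t)"
  using p unfolding Var_def by (simp add: Liminf_epowr[symmetric] besov_quotient_energy epowr_mult epowr_epowr powr_powr)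

text \<open>
  The inequality holds for the energies at every positive time, and it survives the passage to
  lower limits because these are superadditive.
\<close>

lemma sum_Var_layers_le:
  assumes sf: "sigma_finite_measure M"
    and k: "heat_kernel M P k"
    and f: "f \<in> borel_measurable M" and h: "0 \<le> h" and p: "1 \<le> p"
  shows "(\<Sum>i<N. epowr (Var M k p (\<lambda>x. layer (a + real i * h) h \<bar>f x\<bar>)) p) \<le> epowr (Var M k p f) p"
proof -
  let ?g = "\<lambda>i x. layer (a + real i * h) h \<bar>f x\<bar>"
  define w where "w t = ennreal (t powr - (real_of_ereal (critical_exponent M k p) * p))" for t
  have "(\<Sum>i<N. epowr (Var M k p (?g i)) p)
      \<le> Liminf (at_right 0) (\<lambda>t. \<Sum>i<N. w t * heat_energy M k p (?g i) t)"
    unfolding epowr_Var[OF p] w_def by (rule sum_Liminf_le_Liminf_sum) simp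
  also have "\<dots> \<le> Liminf (at_right 0) (\<lambda>t. w t * heat_energy M k p f t)"
  proof (rule Liminf_mono)
    have "eventually (\<lambda>t. 0 < t) (at_right (0::real))"
      by (simp add: eventually_at_right_less)
    then show "eventually (\<lambda>t. (\<Sum>i<N. w t * heat_energy M k p (?g i) t) \<le> w t * heat_energy M k p f t)
        (at_right 0)"
    proof eventually_elim
      case (elim t)
      then have "(\<lambda>(x, y). k t x y) \<in> borel_measurable (M \<Otimes>\<^sub>M M)"
        using k by (simp add: heat_kernel_def)
      from sum_heat_energy_layers_le[where k = k and t = t and N = N and a = a, OF sf this f h p] show ?case
        by (simp add: sum_distrib_left[symmetric] mult_left_mono)
    qed
  qed
  also have "\<dots> = epowr (Var M k p f) p"
    unfolding epowr_Var[OF p] w_def ..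
  finally show ?thesis .
qed

lemma besov_contraction:
  assumes f: "f \<in> besov M k p \<alpha>" and p: "0 < p"
    and g: "g \<in> borel_measurable M"
    and le: "\<And>x. \<bar>g x\<bar> \<le> \<bar>f x\<bar>" and lip: "\<And>x y. \<bar>g x - g y\<bar> \<le> \<bar>f x - f y\<bar>"
  shows "g \<in> besov M k p \<alpha>"
proof -
  have "Lp_norm M p g \<le> Lp_norm M p f"
    unfolding Lp_norm_def using p le
    by (intro epowr_mono nn_integral_mono ennreal_leI powr_mono2) auto
  moreover have "Limsup (at_right 0) (besov_quotient M k p \<alpha> g)
      \<le> Limsup (at_right 0) (besov_quotient M k p \<alpha> f)"
    unfolding besov_quotient_energy[abs_def] using p lip
    by (intro Limsup_mono always_eventually allI mult_left_mono epowr_mono heat_energy_mono) auto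
  ultimately show ?thesis
    using f g unfolding besov_def Lp_def by (auto intro: le_less_trans)
qed

section \<open>Decay of the distribution function across one layer\<close>

lemma heat_kernel_ultracontractive:
  assumes sf: "sigma_finite_measure M" and k: "heat_kernel M P k" and t: "t > 0"
    and B: "AE (x, y) in M \<Otimes>\<^sub>M M. k t x y \<le> B"
    and g: "integrable M g"
  shows "AE x in M. \<bar>P t g x\<bar> \<le> B * (\<integral>y. \<bar>g y\<bar> \<partial>M)"
proof -
  interpret sigma_finite_measure M by fact
  interpret pair_sigma_finite M M ..
  have "g \<in> Lp M 1"
    using g by (auto simp: Lp_def Lp_norm_def integrable_iff_bounded)
  then have "AE x in M. integrable M (\<lambda>y. k t x y * g y) \<and> P t g x = (\<integral>y. k t x y * g y \<partial>M)"
    using k t unfolding heat_kernel_def by blast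
  moreover have "AE x in M. AE y in M. k t x y \<le> B"
    using AE_pair[OF B] by simp
  ultimately show ?thesis
  proof eventually_elim
    case (elim x)
    have nn: "0 \<le> k t x y" for y using k t by (simp add: heat_kernel_def)
    have "\<bar>P t g x\<bar> \<le> (\<integral>y. \<bar>k t x y * g y\<bar> \<partial>M)"
      using elim integral_abs_bound[of M "\<lambda>y. k t x y * g y"] by simp
    also have "\<dots> \<le> (\<integral>y. B * \<bar>g y\<bar> \<partial>M)"
    proof (rule integral_mono_AE)
      show "integrable M (\<lambda>y. \<bar>k t x y * g y\<bar>)" "integrable M (\<lambda>y. B * \<bar>g y\<bar>)"
        using elim g by auto
      show "AE y in M. \<bar>k t x y * g y\<bar> \<le> B * \<bar>g y\<bar>"
        using elim(2) by eventually_elim (use nn in \<open>auto simp: abs_mult intro: mult_right_mono\<close>)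
    qed
    finally show ?case by simp
  qed
qed

lemma superlevel_fmeasurable:
  fixes F :: "'a \<Rightarrow> real"
  assumes F: "integrable M F" and b: "b > 0"
  shows "{x \<in> space M. b \<le> F x} \<in> fmeasurable M"
proof -
  have Fm[measurable]: "F \<in> borel_measurable M" using F by simp
  let ?A = "{x \<in> space M. b \<le> F x}"
  have A: "?A \<in> sets M" by measurable
  then have "integrable M (indicator ?A :: 'a \<Rightarrow> real)"
    using b by (intro Bochner_Integration.integrable_bound[OF integrable_divide_zero[of b, OF F]])
      (auto simp: indicator_def)
  then show ?thesis
    using A by (auto intro: fmeasurableI simp: integrable_indicator_iff less_top)
qed

text \<open>
  At a suitable time \<open>t\<close>, proportional to a power of the measure of \<open>{a \<le> F}\<close>, the function \<open>P\<^sub>t g\<close> is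
  at most half the height of the layer \<open>g\<close>. So \<open>\<bar>P\<^sub>t g - g\<bar>\<close> is large on the set where the layer is
  full, and the Poincare inequality bounds the measure of that set.
\<close>

lemma superlevel_decay_by_layer:
  assumes sf: "sigma_finite_measure M" and k: "heat_kernel M P k"
    and hk: "\<And>t. t > 0 \<Longrightarrow> AE (x, y) in M \<Otimes>\<^sub>M M. k t x y \<le> C\<^sub>h * t powr - \<beta>"
    and pos: "C\<^sub>h > 0" "\<beta> > 0" "p > 1" "C > 0" "h > 0" "a > 0"
    and F: "integrable M F"
    and poincare: "\<And>t. t > 0 \<Longrightarrow> Lp_norm M p (\<lambda>x. P t (\<lambda>x. layer a h (F x)) x - layer a h (F x))
      \<le> ennreal (C * t powr (\<beta> / p)) * V"
    and V: "V < \<infinity>"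
  shows "measure M {x \<in> space M. a + h \<le> F x}
    \<le> 2 powr (p + 1) * C\<^sub>h * C powr p * h powr - p * enn2real (epowr V p)
        * measure M {x \<in> space M. a \<le> F x}"
proof -
  let ?g = "\<lambda>x. layer a h (F x)"
  let ?A = "{x \<in> space M. a \<le> F x}" and ?B = "{x \<in> space M. a + h \<le> F x}"
  have Fm[measurable]: "F \<in> borel_measurable M" using F by simp
  have A: "?A \<in> sets M" "emeasure M ?A < \<infinity>" and B: "?B \<in> sets M" "emeasure M ?B < \<infinity>"
    using superlevel_fmeasurable[OF F, of a] superlevel_fmeasurable[OF F, of "a + h"] pos
    by (auto simp: fmeasurable_def)
  define m where "m = measure M ?A"
  have "measure M ?B \<le> m"
    unfolding m_def using A B pos by (intro measure_mono_fmeasurable) (auto simp: fmeasurable_def)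
  show ?thesis
  proof (cases "m = 0")
    case True
    then show ?thesis using \<open>measure M ?B \<le> m\<close> by (simp add: m_def)
  next
    case False
    then have m: "m > 0" by (simp add: m_def less_le)
    have g_le: "\<bar>?g x\<bar> \<le> h * indicator ?A x" if "x \<in> space M" for x
      using that pos by (auto simp: layer_def indicator_def)
    have int_bound: "integrable M (\<lambda>x. h * indicator ?A x :: real)"
      using A by (auto intro!: integrable_mult_right integrable_real_indicator)
    have g[measurable]: "?g \<in> borel_measurable M"
      unfolding layer_def by measurable
    have int_g: "integrable M ?g"
      using g_le pos by (intro Bochner_Integration.integrable_bound[OF int_bound]) (auto intro!: AE_I2)
    have "(\<integral>x. \<bar>?g x\<bar> \<partial>M) \<le> (\<integral>x. h * indicator ?A x \<partial>M)"
      using int_g int_bound g_le by (intro integral_mono) auto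
    then have norm_g: "(\<integral>x. \<bar>?g x\<bar> \<partial>M) \<le> h * m"
      using A by (simp add: m_def)
    (* The mass of the layer is at most h * m, so at this time the kernel bound, which is
       C\<^sub>h * t powr - \<beta> = 1 / (2 * m), brings it down to half the height of the layer. *)
    define t where "t = (2 * C\<^sub>h * m) powr (1 / \<beta>)"
    have t: "t > 0" "t powr \<beta> = 2 * C\<^sub>h * m"
      using pos m by (auto simp: t_def powr_powr)
    have small: "AE x in M. \<bar>P t ?g x\<bar> \<le> h / 2"
      using heat_kernel_ultracontractive[OF sf k t(1) hk[OF t(1)] int_g]
    proof eventually_elim
      case (elim x)
      also have "C\<^sub>h * t powr - \<beta> * (\<integral>x. \<bar>?g x\<bar> \<partial>M) \<le> C\<^sub>h * t powr - \<beta> * (h * m)"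
        using norm_g pos by (intro mult_left_mono) auto
      also have "\<dots> = h / 2"
        using t pos m by (simp add: powr_minus field_simps)
      finally show ?case .
    qed
    define I where "I = (\<integral>\<^sup>+x. ennreal (\<bar>P t ?g x - ?g x\<bar> powr p) \<partial>M)"
    have "ennreal ((h / 2) powr p) * emeasure M ?B = (\<integral>\<^sup>+x. ennreal ((h / 2) powr p) * indicator ?B x \<partial>M)"
      using B by (simp add: nn_integral_cmult_indicator)
    also have "\<dots> \<le> I"
      unfolding I_def
    proof (rule nn_integral_mono_AE)
      show "AE x in M. ennreal ((h / 2) powr p) * indicator ?B x \<le> ennreal (\<bar>P t ?g x - ?g x\<bar> powr p)"
        using small
      proof eventually_elim
        case (elim x)
        have "h / 2 \<le> \<bar>P t ?g x - ?g x\<bar>" if "a + h \<le> F x"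
        proof -
          have "?g x = h" using that pos by (simp add: layer_def)
          then show ?thesis using elim by simp
        qed
        then show ?case
          using pos by (auto simp: indicator_def intro!: ennreal_leI powr_mono2)
      qed
    qed
    also have "I = epowr (Lp_norm M p (\<lambda>x. P t ?g x - ?g x)) p"
      using pos by (simp add: Lp_norm_def I_def epowr_epowr)
    also have "\<dots> \<le> epowr (ennreal (C * t powr (\<beta> / p)) * V) p"
      using pos by (intro epowr_mono poincare t) auto
    also have "\<dots> = ennreal (C powr p * (2 * C\<^sub>h * m)) * epowr V p"
      using pos t by (simp add: epowr_mult powr_mult powr_powr)
    finally have "ennreal ((h / 2) powr p) * emeasure M ?B \<le> ennreal (C powr p * (2 * C\<^sub>h * m)) * epowr V p" .
    moreover have "emeasure M ?B = ennreal (measure M ?B)"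
      using B by (simp add: emeasure_eq_ennreal_measure)
    moreover have "epowr V p = ennreal (enn2real (epowr V p))"
      using V by (auto simp: epowr_def)
    ultimately have "ennreal ((h / 2) powr p * measure M ?B)
        \<le> ennreal (C powr p * (2 * C\<^sub>h * m) * enn2real (epowr V p))"
      using pos m by (simp add: ennreal_mult)
    then have "(h / 2) powr p * measure M ?B \<le> C powr p * (2 * C\<^sub>h * m) * enn2real (epowr V p)"
      using pos m by (subst (asm) ennreal_le_iff) auto
    then show ?thesis
      using pos by (simp add: m_def[symmetric] powr_divide powr_minus powr_add field_simps)
  qed
qed

section \<open>Exponential decay of the tail\<close>

text \<open>
  The weights \<open>w i\<close> stand for the \<open>p\<close>-th powers of the variations of \<open>N\<close> consecutive layers. How
  the variation is distributed among the layers is unknown, but by the inequality of means the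
  product of the \<open>w i\<close> is largest when all are \<open>1 / N\<close>; the height \<open>h\<close> is chosen so that each
  layer then contributes a factor \<open>1 / e\<close>.
\<close>

lemma exponential_decay_of_tail:
  fixes \<nu> :: "real \<Rightarrow> real" and w :: "nat \<Rightarrow> real"
  assumes p: "p > 1" and D: "D > 0" and N: "N > 0"
    and nn: "\<And>s. 0 \<le> \<nu> s" "\<And>i. 0 \<le> w i"
    and K: "K = (exp 1 * D) powr (1 / p)" and h: "h = K * real N powr (- 1 / p)"
    and step: "\<And>i. i < N \<Longrightarrow> \<nu> (a + real (Suc i) * h) \<le> D * h powr - p * w i * \<nu> (a + real i * h)"
    and w: "(\<Sum>i<N. w i) \<le> 1"
  shows "\<nu> (a + real N * h) \<le> exp (- real N) * \<nu> a"
proof -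
  have Kp: "K powr p = exp 1 * D" and K0: "K > 0"
    using p D by (auto simp: K powr_powr)
  have "(real N powr (- 1 / p)) powr - p = real N"
    unfolding powr_powr using N p by simp
  then have "h powr - p = real N / (exp 1 * D)"
    unfolding h powr_mult by (simp add: powr_minus Kp divide_inverse mult.commute)
  then have Dh: "D * h powr - p = exp (- 1) * real N"
    using D by (simp add: exp_minus field_simps)
  have "\<nu> (a + real j * h) \<le> (\<Prod>i<j. D * h powr - p * w i) * \<nu> a" if "j \<le> N" for j
    using that
  proof (induction j)
    case (Suc j)
    have "\<nu> (a + real (Suc j) * h) \<le> D * h powr - p * w j * \<nu> (a + real j * h)"
      using step[of j] Suc by simp
    also have "\<dots> \<le> D * h powr - p * w j * ((\<Prod>i<j. D * h powr - p * w i) * \<nu> a)"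
      using Suc D nn by (intro mult_left_mono) auto
    finally show ?case by (simp add: mult_ac)
  qed simp
  from this[of N] have "\<nu> (a + real N * h) \<le> (\<Prod>i<N. D * h powr - p * w i) * \<nu> a" by simp
  also have "(\<Prod>i<N. D * h powr - p * w i) = (exp (- 1) * real N) ^ N * (\<Prod>i<N. w i)"
    by (simp add: Dh prod.distrib power_mult_distrib)
  also have "\<dots> \<le> (exp (- 1) * real N) ^ N * (1 / real N) ^ N"
  proof (rule mult_left_mono)
    have "(\<Prod>i<N. w i) \<le> ((\<Sum>i<N. w i) / real N) ^ N"
      using nn N by (intro prod_le_power_mean) auto
    also have "\<dots> \<le> (1 / real N) ^ N"
      using w nn by (intro power_mono divide_right_mono) (auto intro!: divide_nonneg_nonneg sum_nonneg)
    finally show "(\<Prod>i<N. w i) \<le> (1 / real N) ^ N" .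
  qed auto
  also have "\<dots> = exp (- real N)"
    using N by (simp add: power_mult_distrib[symmetric] exp_of_nat_mult[symmetric])
  finally show ?thesis using nn by (simp add: mult_right_mono)
qed

text \<open>
  The region \<open>F \<ge> K\<close> is covered by shells between consecutive levels \<open>K + K N\<^sup>1\<^sup>/\<^sup>q\<close>. As the upper
  level of the shell \<open>N\<close> is at most \<open>2 K (N + 1)\<^sup>1\<^sup>/\<^sup>q\<close>, the choice of \<open>c\<close> bounds the integrand there by
  \<open>exp ((N + 1) / 2)\<close>, which grows at half the rate at which the tail decays.
\<close>

lemma exp_integral_le_of_exponential_tail:
  assumes F: "integrable M F" and F0: "\<And>x. 0 \<le> F x" and q: "q > 1" and K: "K > 0"
    and tail: "\<And>N. measure M {x \<in> space M. K + K * real N powr (1 / q) \<le> F x}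
      \<le> exp (- real N) * measure M {x \<in> space M. K \<le> F x}"
    and c: "c = 1 / (2 * (2 * K) powr q)"
  shows "(\<integral>\<^sup>+x. ennreal (exp (c * F x powr q) - 1) \<partial>M)
    \<le> ennreal (exp 1 / K * (1 + 1 / (1 - exp (- 1 / 2)))) * (\<integral>\<^sup>+x. ennreal (F x) \<partial>M)"
proof -
  have Fm[measurable]: "F \<in> borel_measurable M" using F by simp
  define L where "L N = {x \<in> space M. K + K * real N powr (1 / q) \<le> F x}" for N
  have L[measurable]: "L N \<in> sets M" for N unfolding L_def by measurable
  define \<Phi> where "\<Phi> = (\<integral>\<^sup>+x. ennreal (F x) \<partial>M)"
  have \<Phi>: "\<Phi> = ennreal (\<integral>x. F x \<partial>M)" using F F0 by (simp add: \<Phi>_def nn_integral_eq_integral)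
  have c0: "c > 0" using K by (simp add: c)
  have cK: "c * K powr q \<le> 1 / 2"
    using K q powr_mono[of 0 q 2] by (simp add: c powr_mult)
  have low: "exp (c * F x powr q) - 1 \<le> exp 1 / K * F x" if "F x \<le> K" for x
  proof -
    let ?u = "c * F x powr q"
    have "F x powr q = F x * F x powr (q - 1)"
      using F0[of x] by (cases "F x = 0") (auto simp: powr_diff)
    also have "\<dots> \<le> F x * K powr (q - 1)"
      using that F0[of x] q by (intro mult_left_mono powr_mono2) auto
    also have "\<dots> = F x / K * K powr q"
      using K by (simp add: powr_diff)
    finally have "?u \<le> F x / K * (c * K powr q)"
      using mult_left_mono[of "F x powr q" "F x / K * K powr q" c] c0 by (simp add: mult_ac)
    also have "\<dots> \<le> F x / K * (1 / 2)"
      using cK F0[of x] K by (intro mult_left_mono) auto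
    finally have u: "?u \<le> F x / (2 * K)" by simp
    also have "\<dots> \<le> 1" using that K by simp
    finally have u1: "?u \<le> 1" .
    have u0: "0 \<le> ?u" using c0 by simp
    (* This amounts to exp u - 1 \<le> u * exp u. *)
    have "exp ?u * (1 - ?u) \<le> exp ?u * exp (- ?u)"
      using exp_ge_add_one_self[of "- ?u"] by (intro mult_left_mono) auto
    then have "exp ?u - 1 \<le> exp ?u * ?u"
      by (simp add: exp_minus algebra_simps)
    also have "\<dots> \<le> exp 1 * (F x / K)"
    proof (rule mult_mono)
      show "?u \<le> F x / K"
        using u F0[of x] K by (auto intro: order_trans simp: field_simps)
    qed (use u1 u0 in auto)
    finally show ?thesis by simp
  qed
  have high: "\<exists>N. x \<in> L N \<and> exp (c * F x powr q) \<le> exp ((real N + 1) / 2)"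
    if "x \<in> space M" "K \<le> F x" for x
  proof -
    (* Real-valued index of the level F x: solving K + K * r powr (1 / q) = F x for r. *)
    define r where "r = ((F x - K) / K) powr q"
    define N where "N = nat \<lfloor>r\<rfloor>"
    have "r \<ge> 0" by (simp add: r_def)
    then have N: "real N \<le> r" "r \<le> real N + 1" unfolding N_def by linarith+
    have r: "K * r powr (1 / q) = F x - K"
      using that K q by (simp add: r_def powr_powr)
    have "K * real N powr (1 / q) \<le> K * r powr (1 / q)"
      using N K q by (intro mult_left_mono powr_mono2) auto
    then have "x \<in> L N" using that r by (simp add: L_def)
    have "K * r powr (1 / q) \<le> K * (real N + 1) powr (1 / q)"
      using N K q \<open>r \<ge> 0\<close> by (intro mult_left_mono powr_mono2) auto
    moreover have "K * 1 \<le> K * (real N + 1) powr (1 / q)"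
      using K q by (intro mult_left_mono ge_one_powr_ge_zero) auto
    ultimately have "F x \<le> 2 * K * (real N + 1) powr (1 / q)"
      using r by simp
    then have "F x powr q \<le> (2 * K * (real N + 1) powr (1 / q)) powr q"
      using F0 q by (intro powr_mono2) auto
    also have "\<dots> = (2 * K) powr q * (real N + 1)"
      using K q by (subst powr_mult) (auto simp: powr_powr)
    finally have "c * F x powr q \<le> (real N + 1) / 2"
      using K by (simp add: c field_simps)
    with \<open>x \<in> L N\<close> show ?thesis by auto
  qed
  have L_measure: "emeasure M (L N) \<le> ennreal (exp (- real N) / K) * \<Phi>" for N
  proof -
    have "measure M (L N) \<le> exp (- real N) * measure M {x \<in> space M. K \<le> F x}"
      unfolding L_def by (rule tail)
    also have "\<dots> \<le> exp (- real N) * ((\<integral>x. F x \<partial>M) / K)"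
      using F F0 K by (intro mult_left_mono integral_Markov_inequality_measure[where A = "{}"]) auto
    finally have "measure M (L N) \<le> exp (- real N) / K * (\<integral>x. F x \<partial>M)" by simp
    moreover have "L N \<in> fmeasurable M"
      using K unfolding L_def by (intro superlevel_fmeasurable F) (simp add: add_pos_nonneg)
    ultimately show ?thesis
      using K F0 by (simp add: \<Phi> emeasure_eq_measure2 ennreal_mult[symmetric] ennreal_leI)
  qed
  have "(\<integral>\<^sup>+x. ennreal (exp (c * F x powr q) - 1) \<partial>M)
    \<le> (\<integral>\<^sup>+x. ennreal (exp 1 / K) * ennreal (F x)
        + (\<Sum>N. ennreal (exp ((real N + 1) / 2)) * indicator (L N) x) \<partial>M)"
  proof (rule nn_integral_mono)
    fix x assume x: "x \<in> space M"
    show "ennreal (exp (c * F x powr q) - 1) \<le> ennreal (exp 1 / K) * ennreal (F x)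
        + (\<Sum>N. ennreal (exp ((real N + 1) / 2)) * indicator (L N) x)"
    proof (cases "F x \<le> K")
      case True
      then have "ennreal (exp (c * F x powr q) - 1) \<le> ennreal (exp 1 / K) * ennreal (F x)"
        using low[OF True] K F0 by (simp add: ennreal_mult[symmetric] ennreal_leI)
      then show ?thesis by (rule order_trans) simp
    next
      case False
      then obtain N where N: "x \<in> L N" "exp (c * F x powr q) \<le> exp ((real N + 1) / 2)"
        using high[OF x] by auto
      have "ennreal (exp (c * F x powr q) - 1) \<le> ennreal (exp ((real N + 1) / 2)) * indicator (L N) x"
        using N by (auto intro!: ennreal_leI order_trans[OF _ N(2)])
      also have "\<dots> \<le> (\<Sum>N. ennreal (exp ((real N + 1) / 2)) * indicator (L N) x)"
        using sum_le_suminf[OF summableI, of "{N}"] by simp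
      finally show ?thesis by (rule order_trans) simp
    qed
  qed
  also have "\<dots> = ennreal (exp 1 / K) * \<Phi> + (\<Sum>N. ennreal (exp ((real N + 1) / 2)) * emeasure M (L N))"
    by (simp add: nn_integral_add nn_integral_cmult nn_integral_suminf \<Phi>_def)
  also have "\<dots> \<le> ennreal (exp 1 / K) * \<Phi>
      + (\<Sum>N. ennreal (exp 1 / K * exp (- 1 / 2) ^ N) * \<Phi>)"
  proof (intro add_left_mono suminf_le summableI)
    fix N
    have "ennreal (exp ((real N + 1) / 2)) * emeasure M (L N)
      \<le> ennreal (exp ((real N + 1) / 2)) * (ennreal (exp (- real N) / K) * \<Phi>)"
      by (intro mult_left_mono L_measure) simp
    also have "\<dots> = ennreal (exp ((real N + 1) / 2) * (exp (- real N) / K)) * \<Phi>"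
      using K by (subst ennreal_mult) (auto simp: mult.assoc)
    also have "\<dots> \<le> ennreal (exp 1 / K * exp (- 1 / 2) ^ N) * \<Phi>"
    proof (intro mult_right_mono ennreal_leI)
      have "exp ((real N + 1) / 2) * exp (- real N) = exp (1 / 2) * exp (- 1 / 2) ^ N"
        by (simp add: exp_add[symmetric] exp_of_nat_mult[symmetric] field_simps)
      also have "\<dots> \<le> exp 1 * exp (- 1 / 2) ^ N"
        by (intro mult_right_mono) auto
      finally show "exp ((real N + 1) / 2) * (exp (- real N) / K) \<le> exp 1 / K * exp (- 1 / 2) ^ N"
        using K by (simp add: field_simps)
    qed simp
    finally show "ennreal (exp ((real N + 1) / 2)) * emeasure M (L N)
      \<le> ennreal (exp 1 / K * exp (- 1 / 2) ^ N) * \<Phi>" .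
  qed
  also have "(\<Sum>N. ennreal (exp 1 / K * exp (- 1 / 2) ^ N) * \<Phi>)
      = ennreal (exp 1 / K * (1 / (1 - exp (- 1 / 2)))) * \<Phi>"
  proof -
    have "(\<lambda>N. exp 1 / K * exp (- 1 / 2 :: real) ^ N) sums (exp 1 / K * (1 / (1 - exp (- 1 / 2))))"
      by (intro sums_mult geometric_sums) simp
    then have "(\<Sum>N. ennreal (exp 1 / K * exp (- 1 / 2) ^ N))
        = ennreal (exp 1 / K * (1 / (1 - exp (- 1 / 2))))"
      using K by (intro sums_unique[symmetric]) simp
    then show ?thesis by simp
  qed
  also have "ennreal (exp 1 / K) * \<Phi> + \<dots>
      = ennreal (exp 1 / K * (1 + 1 / (1 - exp (- 1 / 2)))) * \<Phi>"
    unfolding distrib_left mult_1_right using K by (subst ennreal_plus) (auto simp: distrib_right)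
  finally show ?thesis unfolding \<Phi>_def .
qed

section \<open>The exponential inequality\<close>

theorem corollary4p7:
  fixes M :: "'a::t2_space measure"
    and \<E> :: "('a \<Rightarrow> real) \<Rightarrow> ('a \<Rightarrow> real) \<Rightarrow> real"
    and \<F> :: "('a \<Rightarrow> real) set"
    and P :: "real \<Rightarrow> ('a \<Rightarrow> real) \<Rightarrow> 'a \<Rightarrow> real"
    and k :: "real \<Rightarrow> 'a \<Rightarrow> 'a \<Rightarrow> real"
    and C\<^sub>h \<beta> p :: real
  assumes "dirichlet_space M \<E> \<F>"
    and "heat_semigroup M \<E> \<F> P"
    and "conservative M P"
    and "heat_kernel M P k"
    and "C\<^sub>h > 0" and "\<beta> > 0"
    and "\<And>t. t > 0 \<Longrightarrow> AE (x, y) in M \<Otimes>\<^sub>M M. k t x y \<le> C\<^sub>h * t powr - \<beta>"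
    and "p > 1"
    and "PPI M P k p"
    and "ereal p * critical_exponent M k p = ereal \<beta>"
  shows "\<exists>c>0. \<exists>C>0. \<forall>f \<in> W1 M k p. Var M k p f = 1 \<longrightarrow>
    (\<integral>\<^sup>+x. ennreal (exp (c * \<bar>f x\<bar> powr (p / (p - 1))) - 1) \<partial>M) \<le> ennreal C * Lp_norm M 1 f"
proof -
  interpret heat_semigroup M \<E> \<F> P by fact
  note sf = sigma_finite_measure_axioms
  note k = \<open>heat_kernel M P k\<close> and p = \<open>p > 1\<close>
  have crit: "real_of_ereal (critical_exponent M k p) = \<beta> / p"
    using \<open>ereal p * critical_exponent M k p = ereal \<beta>\<close> p
    by (cases "critical_exponent M k p") (auto simp: field_simps)
  obtain C\<^sub>P where C\<^sub>P: "C\<^sub>P > 0" and poincare: "\<And>t f. t \<ge> 0 \<Longrightarrow> f \<in> W1 M k p \<Longrightarrow>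
      Lp_norm M p (\<lambda>x. P t f x - f x) \<le> ennreal (C\<^sub>P * t powr (\<beta> / p)) * Var M k p f"
    using \<open>PPI M P k p\<close> unfolding PPI_def crit by blast
  define D where "D = 2 powr (p + 1) * C\<^sub>h * C\<^sub>P powr p"
  define K where "K = (exp 1 * D) powr (1 / p)"
  define q where "q = p / (p - 1)"
  define c where "c = 1 / (2 * (2 * K) powr q)"
  define C where "C = exp 1 / K * (1 + 1 / (1 - exp (- 1 / 2)))"
  have D: "D > 0" using \<open>C\<^sub>h > 0\<close> C\<^sub>P by (simp add: D_def)
  then have K: "K > 0" by (simp add: K_def)
  have q: "q > 1" "1 / q = 1 - 1 / p" using p by (auto simp: q_def field_simps)
  have "c > 0" using K by (simp add: c_def)
  moreover have "C > 0"
    using K by (auto simp: C_def intro!: mult_pos_pos divide_pos_pos add_pos_pos)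
  moreover have "(\<integral>\<^sup>+x. ennreal (exp (c * \<bar>f x\<bar> powr q) - 1) \<partial>M) \<le> ennreal C * Lp_norm M 1 f"
    if f: "f \<in> W1 M k p" and Var: "Var M k p f = 1" for f
  proof (cases "Lp_norm M 1 f = \<infinity>")
    case True
    then show ?thesis using \<open>C > 0\<close> by (simp add: ennreal_mult_top)
  next
    case False
    have fm[measurable]: "f \<in> borel_measurable M" using f by (simp add: W1_def besov_def Lp_def)
    have norm_f: "Lp_norm M 1 f = (\<integral>\<^sup>+x. ennreal \<bar>f x\<bar> \<partial>M)"
      by (simp add: Lp_norm_def)
    have F: "integrable M (\<lambda>x. \<bar>f x\<bar>)"
      using False norm_f by (intro integrableI_bounded) (auto simp: less_top)
    define \<nu> where "\<nu> s = measure M {x \<in> space M. s \<le> \<bar>f x\<bar>}" for s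
    define g where "g a h x = layer a h \<bar>f x\<bar>" for a h x
    have gW: "g a h \<in> W1 M k p" if "a > 0" for a h
      unfolding W1_def
    proof (rule besov_contraction[OF f[unfolded W1_def]])
      show "g a h \<in> borel_measurable M"
        unfolding g_def layer_def by measurable
      show "\<bar>g a h x\<bar> \<le> \<bar>f x\<bar>" for x
        using that by (auto simp: g_def layer_def)
      show "\<bar>g a h x - g a h y\<bar> \<le> \<bar>f x - f y\<bar>" for x y
        unfolding g_def by (rule order_trans[OF layer_lipschitz abs_triangle_ineq3])
    qed (use p in simp)
    have decay: "\<nu> (a + h) \<le> D * h powr - p * enn2real (epowr (Var M k p (g a h)) p) * \<nu> a"
      if "a > 0" "h > 0" "Var M k p (g a h) < \<infinity>" for a h
      using superlevel_decay_by_layer[OF sf k assms(7) \<open>C\<^sub>h > 0\<close> \<open>\<beta> > 0\<close> p C\<^sub>P \<open>h > 0\<close> \<open>a > 0\<close> F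
          _ \<open>Var M k p (g a h) < \<infinity>\<close>] poincare[OF _ gW[of a h]] that
      unfolding g_def \<nu>_def D_def by (simp add: mult_ac)
    (* The N layers fill the range from K up to K + N * h = K + K * N powr (1 / q). *)
    have tail: "\<nu> (K + K * real N powr (1 / q)) \<le> exp (- real N) * \<nu> K" for N
    proof (cases "N = 0")
      case False
      define h where "h = K * real N powr (- 1 / p)"
      have h: "h > 0" using K False by (simp add: h_def)
      define V where "V i = epowr (Var M k p (g (K + real i * h) h)) p" for i
      have "(\<Sum>i<N. V i) \<le> epowr (Var M k p f) p"
        unfolding V_def g_def using sum_Var_layers_le[OF sf k fm] h p by simp
      then have sum_V: "(\<Sum>i<N. V i) \<le> 1"
        using Var p by (simp add: epowr_def)
      have V_fin: "V i < \<infinity>" if "i < N" for i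
        using order_trans[OF member_le_sum[of i "{..<N}" V] sum_V] that
        by (auto intro: le_less_trans[OF _ ennreal_one_less_top])
      have Var_fin: "Var M k p (g (K + real i * h) h) < \<infinity>" if "i < N" for i
        using V_fin[OF that] by (cases "Var M k p (g (K + real i * h) h)") (auto simp: V_def epowr_def)
      have "\<nu> (K + real N * h) \<le> exp (- real N) * \<nu> K"
      proof (rule exponential_decay_of_tail[OF p D _ _ _ K_def h_def])
        show "\<nu> (K + real (Suc i) * h) \<le> D * h powr - p * enn2real (V i) * \<nu> (K + real i * h)"
          if "i < N" for i
          using decay[of "K + real i * h" h] K h Var_fin[OF that]
          by (simp add: V_def add_pos_nonneg algebra_simps)
        have "ennreal (\<Sum>i<N. enn2real (V i)) = (\<Sum>i<N. V i)"
          using V_fin by (subst sum_ennreal[symmetric]) (auto intro!: sum.cong)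
        with sum_V have "ennreal (\<Sum>i<N. enn2real (V i)) \<le> 1"
          by (simp only:)
        then show "(\<Sum>i<N. enn2real (V i)) \<le> 1"
          by (simp only: ennreal_le_1)
      qed (use False in \<open>auto simp: \<nu>_def\<close>)
      also have "real N * h = K * real N powr (1 / q)"
        using False by (simp add: h_def q powr_diff powr_minus_divide)
      finally show ?thesis .
    qed simp
    show ?thesis
      using exp_integral_le_of_exponential_tail[OF F _ q(1) K tail[unfolded \<nu>_def] c_def]
      unfolding norm_f C_def by simp
  qed
  ultimately show ?thesis unfolding q_def by blast
qed

end
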